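(* Let $\mathbf G$ be a coherent canonical system in $\mathcal{L}$, and let $\mathcal{S}\cup\{s\}$ be a set of sequents in $\mathcal L$. Then either there is an $\mathcal{S}$-proof of $s$ from $\mathcal S$ in $\mathbf G$, or there is a $\mathbf G$-legal $\mathcal{L}$-frame which is a model of $\mathcal S$ but not a model of $s$.
   Context: Syntax. $\mathcal{L}$ is a propositional language with atoms $p_1,p_2,\ldots$ and set of formulas $\mathcal{F}$. A sequent is $\Gamma\Rightarrow E$ with $\Gamma$ a finite set of formulas and $E$ a set of formulas with at most one element. A clause is a sequent of atoms. An $\mathcal{L}$-substitution is a map $\sigma:\mathcal{F}\to\mathcal{F}$ commuting with all connectives, extended pointwise to sets ($\sigma(\emptyset)=\emptyset$). A canonical right-introduction rule for an $n$-ary connective $\diamond$ is $\{\Pi_i\Rightarrow E_i\}_{1\le i\le m}/\ \Rightarrow\diamond(p_1,\dots,p_n)$ with $m\ge0$ and $\Pi_i\cup E_i\subseteq\{p_1,\dots,p_n\}$; an application infers $\Gamma\Rightarrow\sigma(\diamond(p_1,\dots,p_n))$ from $\Gamma,\sigma(\Pi_i)\Rightarrow\sigma(E_i)$ ($1\le i\le m$), for any finite $\Gamma$ and substitution $\sigma$. A canonical left-introduction rule is $\langle\{\Pi_i\Rightarrow E_i\}_{1\le i\le m},\{\Sigma_j\Rightarrow\}_{1\le j\le k}\rangle/\ \diamond(p_1,\dots,p_n)\Rightarrow$ with all atoms among $p_1,\dots,p_n$ (hard premises $\Pi_i\Rightarrow E_i$, soft premises $\Sigma_j\Rightarrow$);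 an application infers $\Gamma,\sigma(\diamond(p_1,\dots,p_n))\Rightarrow E$ from $\Gamma,\sigma(\Pi_i)\Rightarrow\sigma(E_i)$ and $\Gamma,\sigma(\Sigma_j)\Rightarrow E$, for any sequent $\Gamma\Rightarrow E$ and substitution $\sigma$. A canonical system has axioms $\varphi\Rightarrow\varphi$, weakening (from $\Gamma\Rightarrow E$ infer $\Gamma,\Delta\Rightarrow E$; from $\Gamma\Rightarrow$ infer $\Gamma\Rightarrow\psi$), cut (from $\Gamma\Rightarrow\varphi$ and $\Delta,\varphi\Rightarrow E$ infer $\Gamma,\Delta\Rightarrow E$; $\varphi$ is the cut formula), and a set of canonical right- and left-introduction rules. A proof of $s$ from $\mathcal S$ is a derivation of $s$ using the sequents of $\mathcal S$ as extra axioms; it is an $\mathcal{S}$-proof iff the cut formula of every cut in it occurs in $\mathcal S$. Coherence. A classical assignment $u$ satisfies a clause $\Pi\Rightarrow E$ iff $u(p)=f$ for some $p\in\Pi$ or $E=\{q\}$ with $u(q)=t$; $\mathbf G$ is coherent iff for every connective $\diamond$, whenever $\mathbf G$ contains a left rule $\langle S_1,S_2\rangle/\diamond(p_1,\dots,p_n)\Rightarrow$ and a right rule $S_3/\Rightarrow\diamond(p_1,\dots,p_n)$, no assignment satisfies all clauses of $S_1\cup S_2\cup S_3$. Semantics. For $\mathcal{U}$ closed under subformulas, a $\mathcal{U}$-semiframe is $\langle W,\le,v\rangle$ with $(W,\le)$ a nonempty partial order and $v:W\times\mathcal{U}\to\{t,f\}$ persistent ($v(a,\varphi)=t$, $a\le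 b$ imply $v(b,\varphi)=t$); an $\mathcal{L}$-frame is an $\mathcal{F}$-semiframe. $\Gamma\Rightarrow E$ is locally true at $a$ iff $\Gamma\cup E\subseteq\mathcal{U}$ and either $v(a,\psi)=f$ for some $\psi\in\Gamma$ or $E=\{\varphi\}$ with $v(a,\varphi)=t$; true at $a$ iff locally true at all $b\ge a$. A semiframe is a model of a sequent iff it is true at every $a$, of a set of sequents iff of each. $\sigma$ (locally) satisfies a clause $\Gamma\Rightarrow E$ at $a$ iff $\sigma(\Gamma)\Rightarrow\sigma(E)$ is (locally) true at $a$. $\sigma$ fulfils a right rule at $a$ iff it satisfies all premises at $a$; a left rule iff it satisfies every hard premise at $a$ and locally satisfies every soft premise at $a$. A semiframe respects a rule $r$ for $\diamond$ iff for all $a$ and $\sigma$: if $\sigma$ fulfils $r$ at $a$ and $\sigma(\diamond(p_1,\dots,p_n))\in\mathcal U$ then $\sigma$ locally satisfies the conclusion of $r$ at $a$. It is $\mathbf G$-legal iff it respects all canonical rules of $\mathbf G$. *)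

theory Defs
  imports Main
begin

text \<open>A propositional language is a partial map \<open>L\<close> from connective symbols to arities:
  \<open>L c = Some n\<close> says that \<open>c\<close> is an \<open>n\<close>-ary connective. The type \<open>'c fm\<close> also
  contains terms that violate the arities; the set of formulas of the language is \<open>formulas L\<close>.
  \<open>Atom i\<close> is the atom \<open>p\<^sub>i\<^sub>+\<^sub>1\<close>, so that \<open>p\<^sub>1, \<dots>, p\<^sub>n\<close> are \<open>Atom i\<close> for \<open>i < n\<close>.\<close>

datatype 'c fm = Atom nat | Con 'c "'c fm list"

inductive_set formulas :: "('c \<rightharpoonup> nat) \<Rightarrow> 'c fm set" for L where
  atom: "Atom i \<in> formulas L"
| con: "L c = Some (length xs) \<Longrightarrow> \<forall>x\<in>set xs. x \<in> formulas L \<Longrightarrow> Con c xs \<in> formulas L"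

definition is_subst :: "('c \<rightharpoonup> nat) \<Rightarrow> ('c fm \<Rightarrow> 'c fm) \<Rightarrow> bool" where
  "is_subst L \<sigma> \<longleftrightarrow> \<sigma> ` formulas L \<subseteq> formulas L \<and>
     (\<forall>c xs. Con c xs \<in> formulas L \<longrightarrow> \<sigma> (Con c xs) = Con c (map \<sigma> xs))"

text \<open>The right-hand side of a sequent, a set with at most one element, is an option.
  Finiteness of the left-hand side is imposed by \<open>is_sequent\<close>.\<close>

datatype 'c sequent = Sequent (lhs: "'c fm set") (rhs: "'c fm option")  (infix "\<turnstile>" 55)

definition seq_fms :: "'c sequent \<Rightarrow> 'c fm set" where
  "seq_fms q = lhs q \<union> set_option (rhs q)"

definition is_sequent :: "('c \<rightharpoonup> nat) \<Rightarrow> 'c sequent \<Rightarrow> bool" where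
  "is_sequent L q \<longleftrightarrow> finite (lhs q) \<and> seq_fms q \<subseteq> formulas L"

definition subst_seq :: "('c fm \<Rightarrow> 'c fm) \<Rightarrow> 'c sequent \<Rightarrow> 'c sequent" where
  "subst_seq \<sigma> q = (\<sigma> ` lhs q \<turnstile> map_option \<sigma> (rhs q))"

text \<open>\<open>RightRule c S\<close> is the rule \<open>S / \<Rightarrow> c(p\<^sub>1, \<dots>, p\<^sub>n)\<close>, and \<open>LeftRule c H S\<close>
  is the rule \<open>\<langle>H, S\<rangle> / c(p\<^sub>1, \<dots>, p\<^sub>n) \<Rightarrow>\<close> with hard premises \<open>H\<close> and soft premises \<open>S\<close>.\<close>

datatype 'c rule =
    RightRule 'c "'c sequent set"
  | LeftRule 'c "'c sequent set" "'c sequent set"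

definition principal :: "('c \<rightharpoonup> nat) \<Rightarrow> 'c \<Rightarrow> 'c fm" where
  "principal L c = Con c (map Atom [0..<the (L c)])"

definition clauses_over :: "nat \<Rightarrow> 'c sequent set \<Rightarrow> bool" where
  "clauses_over n Q \<longleftrightarrow> finite Q \<and> (\<forall>q\<in>Q. seq_fms q \<subseteq> Atom ` {..<n})"

fun canonical_rule :: "('c \<rightharpoonup> nat) \<Rightarrow> 'c rule \<Rightarrow> bool" where
  "canonical_rule L (RightRule c S) \<longleftrightarrow> (\<exists>n. L c = Some n \<and> clauses_over n S)"
| "canonical_rule L (LeftRule c H S) \<longleftrightarrow>
     (\<exists>n. L c = Some n \<and> clauses_over n H \<and> clauses_over n S \<and> (\<forall>q\<in>S. rhs q = None))"

text \<open>Axioms, weakening and cut belong to every canonical system, so a system is given by its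
  set of introduction rules.\<close>

definition canonical_system :: "('c \<rightharpoonup> nat) \<Rightarrow> 'c rule set \<Rightarrow> bool" where
  "canonical_system L G \<longleftrightarrow> (\<forall>r\<in>G. canonical_rule L r)"

text \<open>\<open>provable L G \<S> C q\<close>: there is a proof of \<open>q\<close> from \<open>\<S>\<close> in \<open>G\<close> all of whose cut
  formulas belong to \<open>C\<close>. Unrestricted proofs are obtained for \<open>C = formulas L\<close>.\<close>

inductive provable ::
  "('c \<rightharpoonup> nat) \<Rightarrow> 'c rule set \<Rightarrow> 'c sequent set \<Rightarrow> 'c fm set \<Rightarrow> 'c sequent \<Rightarrow> bool"
  for L G \<S> C where
  assumption: "q \<in> \<S> \<Longrightarrow> provable L G \<S> C q"
| axiom: "\<phi> \<in> formulas L \<Longrightarrow> provable L G \<S> C ({\<phi>} \<turnstile> Some \<phi>)"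
| weaken_left: "provable L G \<S> C (\<Gamma> \<turnstile> E) \<Longrightarrow> finite \<Delta> \<Longrightarrow> \<Delta> \<subseteq> formulas L \<Longrightarrow>
    provable L G \<S> C (\<Gamma> \<union> \<Delta> \<turnstile> E)"
| weaken_right: "provable L G \<S> C (\<Gamma> \<turnstile> None) \<Longrightarrow> \<psi> \<in> formulas L \<Longrightarrow>
    provable L G \<S> C (\<Gamma> \<turnstile> Some \<psi>)"
| cut: "provable L G \<S> C (\<Gamma> \<turnstile> Some \<phi>) \<Longrightarrow> provable L G \<S> C (\<Delta> \<union> {\<phi>} \<turnstile> E) \<Longrightarrow>
    is_sequent L (\<Delta> \<turnstile> E) \<Longrightarrow> \<phi> \<in> C \<Longrightarrow> provable L G \<S> C (\<Gamma> \<union> \<Delta> \<turnstile> E)"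
| right: "RightRule c S \<in> G \<Longrightarrow> is_subst L \<sigma> \<Longrightarrow> finite \<Gamma> \<Longrightarrow> \<Gamma> \<subseteq> formulas L \<Longrightarrow>
    \<forall>q\<in>S. provable L G \<S> C (\<Gamma> \<union> \<sigma> ` lhs q \<turnstile> map_option \<sigma> (rhs q)) \<Longrightarrow>
    provable L G \<S> C (\<Gamma> \<turnstile> Some (\<sigma> (principal L c)))"
| left: "LeftRule c H S \<in> G \<Longrightarrow> is_subst L \<sigma> \<Longrightarrow> is_sequent L (\<Gamma> \<turnstile> E) \<Longrightarrow>
    \<forall>q\<in>H. provable L G \<S> C (\<Gamma> \<union> \<sigma> ` lhs q \<turnstile> map_option \<sigma> (rhs q)) \<Longrightarrow>
    \<forall>q\<in>S. provable L G \<S> C (\<Gamma> \<union> \<sigma> ` lhs q \<turnstile> E) \<Longrightarrow>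
    provable L G \<S> C (\<Gamma> \<union> {\<sigma> (principal L c)} \<turnstile> E)"

text \<open>A formula occurs in \<open>\<S>\<close> if it is a member of one side of a sequent of \<open>\<S>\<close>;
  being a proper subformula of such a member does not count.\<close>

definition S_provable :: "('c \<rightharpoonup> nat) \<Rightarrow> 'c rule set \<Rightarrow> 'c sequent set \<Rightarrow> 'c sequent \<Rightarrow> bool" where
  "S_provable L G \<S> q \<longleftrightarrow> provable L G \<S> (\<Union>p\<in>\<S>. seq_fms p) q"

definition assignment_sat :: "(nat \<Rightarrow> bool) \<Rightarrow> 'c sequent \<Rightarrow> bool" where
  "assignment_sat u q \<longleftrightarrow>
     (\<exists>i. Atom i \<in> lhs q \<and> \<not> u i) \<or> (\<exists>i. rhs q = Some (Atom i) \<and> u i)"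

definition coherent :: "'c rule set \<Rightarrow> bool" where
  "coherent G \<longleftrightarrow> (\<forall>c S\<^sub>1 S\<^sub>2 S\<^sub>3. LeftRule c S\<^sub>1 S\<^sub>2 \<in> G \<longrightarrow> RightRule c S\<^sub>3 \<in> G \<longrightarrow>
     (\<nexists>u. \<forall>q \<in> S\<^sub>1 \<union> S\<^sub>2 \<union> S\<^sub>3. assignment_sat u q))"

text \<open>In a semiframe over \<open>U\<close> only the values \<open>val M a \<phi>\<close> with
  \<open>a \<in> worlds M\<close> and \<open>\<phi> \<in> U\<close> are meaningful.\<close>

record ('w, 'c) semiframe =
  worlds :: "'w set"
  leq :: "('w \<times> 'w) set"
  val :: "'w \<Rightarrow> 'c fm \<Rightarrow> bool"

definition subformula_closed :: "'c fm set \<Rightarrow> bool" where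
  "subformula_closed U \<longleftrightarrow> (\<forall>c xs. Con c xs \<in> U \<longrightarrow> set xs \<subseteq> U)"

definition is_semiframe :: "('c \<rightharpoonup> nat) \<Rightarrow> 'c fm set \<Rightarrow> ('w, 'c) semiframe \<Rightarrow> bool" where
  "is_semiframe L U M \<longleftrightarrow>
     U \<subseteq> formulas L \<and> subformula_closed U \<and>
     worlds M \<noteq> {} \<and> partial_order_on (worlds M) (leq M) \<and>
     (\<forall>a b. \<forall>\<phi>\<in>U. (a, b) \<in> leq M \<longrightarrow> val M a \<phi> \<longrightarrow> val M b \<phi>)"

definition is_frame :: "('c \<rightharpoonup> nat) \<Rightarrow> ('w, 'c) semiframe \<Rightarrow> bool" where
  "is_frame L M \<longleftrightarrow> is_semiframe L (formulas L) M"

definition locally_true :: "'c fm set \<Rightarrow> ('w, 'c) semiframe \<Rightarrow> 'w \<Rightarrow> 'c sequent \<Rightarrow> bool" where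
  "locally_true U M a q \<longleftrightarrow> seq_fms q \<subseteq> U \<and>
     ((\<exists>\<psi>\<in>lhs q. \<not> val M a \<psi>) \<or> (\<exists>\<phi>. rhs q = Some \<phi> \<and> val M a \<phi>))"

definition true_at :: "'c fm set \<Rightarrow> ('w, 'c) semiframe \<Rightarrow> 'w \<Rightarrow> 'c sequent \<Rightarrow> bool" where
  "true_at U M a q \<longleftrightarrow> (\<forall>b. (a, b) \<in> leq M \<longrightarrow> locally_true U M b q)"

definition is_model :: "'c fm set \<Rightarrow> ('w, 'c) semiframe \<Rightarrow> 'c sequent \<Rightarrow> bool" where
  "is_model U M q \<longleftrightarrow> (\<forall>a\<in>worlds M. true_at U M a q)"

fun fulfils :: "'c fm set \<Rightarrow> ('w, 'c) semiframe \<Rightarrow> 'w \<Rightarrow> ('c fm \<Rightarrow> 'c fm) \<Rightarrow> 'c rule \<Rightarrow> bool" where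
  "fulfils U M a \<sigma> (RightRule c S) \<longleftrightarrow> (\<forall>q\<in>S. true_at U M a (subst_seq \<sigma> q))"
| "fulfils U M a \<sigma> (LeftRule c H S) \<longleftrightarrow>
     (\<forall>q\<in>H. true_at U M a (subst_seq \<sigma> q)) \<and> (\<forall>q\<in>S. locally_true U M a (subst_seq \<sigma> q))"

fun rule_connective :: "'c rule \<Rightarrow> 'c" where
  "rule_connective (RightRule c S) = c"
| "rule_connective (LeftRule c H S) = c"

fun rule_conclusion :: "('c \<rightharpoonup> nat) \<Rightarrow> 'c rule \<Rightarrow> 'c sequent" where
  "rule_conclusion L (RightRule c S) = ({} \<turnstile> Some (principal L c))"
| "rule_conclusion L (LeftRule c H S) = ({principal L c} \<turnstile> None)"

definition respects_rule ::
  "('c \<rightharpoonup> nat) \<Rightarrow> 'c fm set \<Rightarrow> ('w, 'c) semiframe \<Rightarrow> 'c rule \<Rightarrow> bool" where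
  "respects_rule L U M r \<longleftrightarrow> (\<forall>a\<in>worlds M. \<forall>\<sigma>. is_subst L \<sigma> \<longrightarrow> fulfils U M a \<sigma> r \<longrightarrow>
     \<sigma> (principal L (rule_connective r)) \<in> U \<longrightarrow>
     locally_true U M a (subst_seq \<sigma> (rule_conclusion L r)))"

definition legal ::
  "('c \<rightharpoonup> nat) \<Rightarrow> 'c rule set \<Rightarrow> 'c fm set \<Rightarrow> ('w, 'c) semiframe \<Rightarrow> bool" where
  "legal L G U M \<longleftrightarrow> (\<forall>r\<in>G. respects_rule L U M r)"

end

theory Submission
  imports Defs
begin

text \<open>Call a theory \<open>T\<close> \<open>E\<close>-maximal if it does not derive \<open>E\<close> but every proper extension does.
  The worlds are the \<open>E\<close>-maximal theories, for all \<open>E\<close>, ordered by inclusion, and a compound formula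
  is true at \<open>T\<close> if it belongs to \<open>T\<close> or if a right rule for it is fulfilled at \<open>T\<close>. Without general
  cuts, truth and membership need not coincide; but members of \<open>T\<close> are true at \<open>T\<close>, \<open>\<phi>\<close> is false
  at \<open>\<phi>\<close>-maximal theories, and for cut formulas truth is membership. This suffices: a premise that
  is true at \<open>T\<close> is derivable from \<open>T\<close>, since otherwise an extension of \<open>T\<close> would falsify it. Hence a
  fulfilled left rule excludes its principal formula from \<open>T\<close>, while coherence excludes that a
  right rule for this formula is fulfilled as well.\<close>

section \<open>Substitutions and instances of the principal formula\<close>

lemma subst_principal:
  assumes \<sigma>: "is_subst L \<sigma>" and c: "L c = Some n"
  shows "\<sigma> (principal L c) = Con c (map (\<lambda>i. \<sigma> (Atom i)) [0..<n])"
proof -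
  have "principal L c \<in> formulas L"
    using c by (auto simp: principal_def intro!: formulas.con formulas.atom)
  then show ?thesis using \<sigma> c by (simp add: is_subst_def principal_def comp_def)
qed

lemma formulas_ConE:
  assumes "Con c xs \<in> formulas L"
  obtains "L c = Some (length xs)" "set xs \<subseteq> formulas L"
  using assms by (cases rule: formulas.cases) auto

text \<open>Rules act on formulas only through substitutions. With \<open>as\<close> the argument
  list of a compound formula, \<open>inst as\<close> exhibits that formula as an instance of
  \<open>principal L c\<close>; atoms beyond the list stay fixed.\<close>

primrec inst :: "'c fm list \<Rightarrow> 'c fm \<Rightarrow> 'c fm" where
  "inst as (Atom i) = (if i < length as then as ! i else Atom i)"
| "inst as (Con c xs) = Con c (map (inst as) xs)"

lemma is_subst_inst:
  assumes "set as \<subseteq> formulas L"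
  shows "is_subst L (inst as)"
proof -
  have "inst as \<phi> \<in> formulas L" if "\<phi> \<in> formulas L" for \<phi>
    using that
  proof induction
    case (atom i)
    then show ?case using assms by (auto intro: formulas.atom)
  next
    case (con c xs)
    then show ?case by (auto intro!: formulas.con)
  qed
  then show ?thesis by (auto simp: is_subst_def)
qed

section \<open>Derivability from possibly infinite theories\<close>

locale canonical_calculus =
  fixes L :: "'c \<rightharpoonup> nat" and G :: "'c rule set"
    and \<S> :: "'c sequent set" and C :: "'c fm set"
  assumes canonical: "canonical_system L G"
    and sequents: "\<And>q. q \<in> \<S> \<Longrightarrow> is_sequent L q"
begin

abbreviation prv :: "'c sequent \<Rightarrow> bool" where
  "prv \<equiv> provable L G \<S> C"

text \<open>Sequents have finite left-hand sides while theories may be infinite, so compactness is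
  built into the notion.\<close>

definition derives :: "'c fm set \<Rightarrow> 'c fm option \<Rightarrow> bool" where
  "derives T E \<longleftrightarrow> (\<exists>\<Gamma>. finite \<Gamma> \<and> \<Gamma> \<subseteq> T \<and> prv (\<Gamma> \<turnstile> E))"

lemma derives_mono: "derives T E \<Longrightarrow> T \<subseteq> T' \<Longrightarrow> derives T' E"
  unfolding derives_def by blast

lemma derives_refl: "\<phi> \<in> T \<Longrightarrow> \<phi> \<in> formulas L \<Longrightarrow> derives T (Some \<phi>)"
  unfolding derives_def by (rule exI[of _ "{\<phi>}"]) (auto intro: provable.axiom)

lemma derives_weaken_right:
  assumes "derives T None" "set_option E \<subseteq> formulas L"
  shows "derives T E"
  using assms unfolding derives_def by (cases E) (auto intro: provable.weaken_right)

lemma prv_weaken_left: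
  assumes "prv (\<Gamma> \<turnstile> E)" "\<Gamma> \<subseteq> \<Delta>" "finite \<Delta>" "\<Delta> \<subseteq> formulas L"
  shows "prv (\<Delta> \<turnstile> E)"
  using provable.weaken_left[OF assms(1,3,4)] assms(2) by (simp add: Un_absorb1)

lemma derives_cut:
  assumes "derives T (Some \<phi>)" "derives (insert \<phi> T) E" "\<phi> \<in> C" "\<phi> \<in> formulas L"
    "T \<subseteq> formulas L" "set_option E \<subseteq> formulas L"
  shows "derives T E"
proof -
  obtain \<Gamma> \<Delta> where \<Gamma>: "finite \<Gamma>" "\<Gamma> \<subseteq> T" "prv (\<Gamma> \<turnstile> Some \<phi>)"
    and \<Delta>: "finite \<Delta>" "\<Delta> \<subseteq> insert \<phi> T" "prv (\<Delta> \<turnstile> E)"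
    using assms(1,2) unfolding derives_def by blast
  \<comment> \<open>\<open>\<Delta>\<close> may or may not contain \<open>\<phi>\<close>; removing
    and re-adding it gives the shape that the cut rule expects.\<close>
  have "prv ((\<Delta> - {\<phi>}) \<union> {\<phi>} \<turnstile> E)"
    by (rule prv_weaken_left[OF \<Delta>(3)]) (use \<Delta> assms in auto)
  moreover have "is_sequent L (\<Delta> - {\<phi>} \<turnstile> E)"
    using \<Delta> assms by (auto simp: is_sequent_def seq_fms_def)
  ultimately have "prv (\<Gamma> \<union> (\<Delta> - {\<phi>}) \<turnstile> E)"
    using provable.cut \<Gamma>(3) assms(3) by metis
  then show ?thesis
    unfolding derives_def using \<Gamma> \<Delta> by (intro exI[of _ "\<Gamma> \<union> (\<Delta> - {\<phi>})"]) auto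
qed

text \<open>A rule demands one context for all its premises. Finitely many derivations use only
  finitely many formulas of \<open>T\<close>; these are collected and the premises weakened to
  them.\<close>

lemma derives_finite_common:
  assumes "finite Q" "\<And>q. q \<in> Q \<Longrightarrow> finite (A q) \<and> A q \<subseteq> formulas L"
    "\<And>q. q \<in> Q \<Longrightarrow> derives (T \<union> A q) (E q)" "T \<subseteq> formulas L"
  obtains \<Gamma> where "finite \<Gamma>" "\<Gamma> \<subseteq> T" "\<And>q. q \<in> Q \<Longrightarrow> prv (\<Gamma> \<union> A q \<turnstile> E q)"
proof -
  have "\<forall>q\<in>Q. \<exists>\<Gamma>. finite \<Gamma> \<and> \<Gamma> \<subseteq> T \<union> A q \<and> prv (\<Gamma> \<turnstile> E q)"
    using assms(3) unfolding derives_def by blast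
  then obtain g where g: "\<And>q. q \<in> Q \<Longrightarrow> finite (g q) \<and> g q \<subseteq> T \<union> A q \<and> prv (g q \<turnstile> E q)"
    by metis
  \<comment> \<open>Intersecting with \<open>T\<close> discards formulas that come only from some
    \<open>A q\<close>; each premise gets its own \<open>A q\<close> back separately.\<close>
  define \<Gamma> where "\<Gamma> = T \<inter> (\<Union>q\<in>Q. g q)"
  have fin: "finite \<Gamma>" using assms(1) g by (simp add: \<Gamma>_def)
  show thesis
  proof
    fix q assume q: "q \<in> Q"
    have "g q \<subseteq> \<Gamma> \<union> A q" using g[OF q] q by (auto simp: \<Gamma>_def)
    moreover have "\<Gamma> \<subseteq> formulas L" using assms(4) by (auto simp: \<Gamma>_def)
    ultimately show "prv (\<Gamma> \<union> A q \<turnstile> E q)"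
      using prv_weaken_left g[OF q] fin assms(2)[OF q] by (metis Un_least finite_UnI)
  qed (use fin in \<open>auto simp: \<Gamma>_def\<close>)
qed

lemma clause_formulas:
  assumes "clauses_over n Q" "q \<in> Q"
  shows "finite (lhs q)" "seq_fms q \<subseteq> formulas L"
proof -
  have q: "seq_fms q \<subseteq> Atom ` {..<n}" using assms by (auto simp: clauses_over_def)
  then show "seq_fms q \<subseteq> formulas L" by (auto intro: formulas.atom)
  from q have "lhs q \<subseteq> Atom ` {..<n}" by (auto simp: seq_fms_def)
  then show "finite (lhs q)" by (rule finite_subset) simp
qed

lemma subst_clause_formulas:
  assumes "clauses_over n Q" "q \<in> Q" "is_subst L \<sigma>"
  shows "finite (\<sigma> ` lhs q)" "\<sigma> ` lhs q \<subseteq> formulas L"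
    "set_option (map_option \<sigma> (rhs q)) \<subseteq> formulas L"
  using clause_formulas[OF assms(1,2)] assms(3)
  by (auto simp: is_subst_def seq_fms_def option.set_map)

lemma derives_right:
  assumes "RightRule c Q \<in> G" "is_subst L \<sigma>" "T \<subseteq> formulas L"
    "\<And>q. q \<in> Q \<Longrightarrow> derives (T \<union> \<sigma> ` lhs q) (map_option \<sigma> (rhs q))"
  shows "derives T (Some (\<sigma> (principal L c)))"
proof -
  obtain n where n: "clauses_over n Q"
    using canonical assms(1) unfolding canonical_system_def by fastforce
  then have "finite Q" by (simp add: clauses_over_def)
  then obtain \<Gamma> where \<Gamma>: "finite \<Gamma>" "\<Gamma> \<subseteq> T"
    "\<And>q. q \<in> Q \<Longrightarrow> prv (\<Gamma> \<union> \<sigma> ` lhs q \<turnstile> map_option \<sigma> (rhs q))"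
    by (rule derives_finite_common[of Q "\<lambda>q. \<sigma> ` lhs q" T "\<lambda>q. map_option \<sigma> (rhs q)"])
      (use subst_clause_formulas[OF n _ assms(2)] assms in auto)
  then have "prv (\<Gamma> \<turnstile> Some (\<sigma> (principal L c)))"
    using assms by (intro provable.right) auto
  then show ?thesis unfolding derives_def using \<Gamma> by blast
qed

text \<open>The rule adds its principal formula to the context; as this formula already lies in
  \<open>T\<close>, the new context remains a subset of \<open>T\<close>.\<close>

lemma derives_left:
  assumes "LeftRule c H Q \<in> G" "is_subst L \<sigma>" "T \<subseteq> formulas L" "set_option E \<subseteq> formulas L"
    and hard: "\<And>q. q \<in> H \<Longrightarrow> derives (T \<union> \<sigma> ` lhs q) (map_option \<sigma> (rhs q))"
    and soft: "\<And>q. q \<in> Q \<Longrightarrow> derives (T \<union> \<sigma> ` lhs q) E"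
    and principal: "\<sigma> (principal L c) \<in> T"
  shows "derives T E"
proof -
  obtain n where n: "clauses_over n H" "clauses_over n Q"
    using canonical assms(1) unfolding canonical_system_def by fastforce
  then have "finite H" "finite Q" by (simp_all add: clauses_over_def)
  obtain \<Gamma> where \<Gamma>: "finite \<Gamma>" "\<Gamma> \<subseteq> T"
    "\<And>q. q \<in> H \<Longrightarrow> prv (\<Gamma> \<union> \<sigma> ` lhs q \<turnstile> map_option \<sigma> (rhs q))"
    using \<open>finite H\<close>
    by (rule derives_finite_common[of H "\<lambda>q. \<sigma> ` lhs q" T "\<lambda>q. map_option \<sigma> (rhs q)"])
      (use subst_clause_formulas[OF n(1) _ assms(2)] assms in auto)
  obtain \<Delta> where \<Delta>: "finite \<Delta>" "\<Delta> \<subseteq> T" "\<And>q. q \<in> Q \<Longrightarrow> prv (\<Delta> \<union> \<sigma> ` lhs q \<turnstile> E)"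
    using \<open>finite Q\<close>
    by (rule derives_finite_common[of Q "\<lambda>q. \<sigma> ` lhs q" T "\<lambda>_. E"])
      (use subst_clause_formulas[OF n(2) _ assms(2)] assms in auto)
  have "prv ((\<Gamma> \<union> \<Delta>) \<union> \<sigma> ` lhs q \<turnstile> map_option \<sigma> (rhs q))" if "q \<in> H" for q
    by (rule prv_weaken_left[OF \<Gamma>(3)[OF that]])
      (use \<Gamma> \<Delta> assms(3) subst_clause_formulas[OF n(1) that assms(2)] in auto)
  moreover have "prv ((\<Gamma> \<union> \<Delta>) \<union> \<sigma> ` lhs q \<turnstile> E)" if "q \<in> Q" for q
    by (rule prv_weaken_left[OF \<Delta>(3)[OF that]])
      (use \<Gamma> \<Delta> assms(3) subst_clause_formulas[OF n(2) that assms(2)] in auto)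
  moreover have "is_sequent L (\<Gamma> \<union> \<Delta> \<turnstile> E)"
    using \<Gamma> \<Delta> assms(3,4) by (auto simp: is_sequent_def seq_fms_def)
  ultimately have "prv ((\<Gamma> \<union> \<Delta>) \<union> {\<sigma> (principal L c)} \<turnstile> E)"
    using assms(1,2) by (intro provable.left) auto
  then show ?thesis unfolding derives_def
    using \<Gamma> \<Delta> principal by (intro exI[of _ "(\<Gamma> \<union> \<Delta>) \<union> {\<sigma> (principal L c)}"]) auto
qed

section \<open>Maximal theories\<close>

definition maximal_theory :: "'c fm option \<Rightarrow> 'c fm set \<Rightarrow> bool" where
  "maximal_theory E T \<longleftrightarrow> T \<subseteq> formulas L \<and> set_option E \<subseteq> formulas L \<and> \<not> derives T E \<and>
     (\<forall>\<phi>\<in>formulas L - T. derives (insert \<phi> T) E)"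

text \<open>A Lindenbaum extension by Zorn's lemma. Non-derivability of \<open>E\<close> survives
  unions of chains because a derivation uses finitely many formulas, all in one member of the
  chain.\<close>

lemma maximal_theory_extension:
  assumes "\<not> derives T E" "T \<subseteq> formulas L" "set_option E \<subseteq> formulas L"
  obtains T' where "maximal_theory E T'" "T \<subseteq> T'"
proof -
  let ?A = "{X. T \<subseteq> X \<and> X \<subseteq> formulas L \<and> \<not> derives X E}"
  have "\<exists>X\<in>?A. \<forall>Y\<in>?A. X \<subseteq> Y \<longrightarrow> Y = X"
  proof (rule subset_Zorn_nonempty)
    show "?A \<noteq> {}" using assms by auto
  next
    fix K assume K: "K \<noteq> {}" "subset.chain ?A K"
    have "\<not> derives (\<Union>K) E"
    proof
      assume "derives (\<Union>K) E"
      then obtain \<Gamma> where \<Gamma>: "finite \<Gamma>" "\<Gamma> \<subseteq> \<Union>K" "prv (\<Gamma> \<turnstile> E)"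
        unfolding derives_def by blast
      then obtain X where "X \<in> K" "\<Gamma> \<subseteq> X"
        using finite_subset_Union_chain[OF \<Gamma>(1,2) K] by metis
      moreover from this(1) have "\<not> derives X E" using K by (auto simp: subset.chain_def)
      ultimately show False using \<Gamma> unfolding derives_def by blast
    qed
    moreover have "T \<subseteq> \<Union>K" "\<Union>K \<subseteq> formulas L"
      using K unfolding subset.chain_def by blast+
    ultimately show "\<Union>K \<in> ?A" by simp
  qed
  then obtain X where X: "X \<in> ?A" and max: "\<forall>Y\<in>?A. X \<subseteq> Y \<longrightarrow> Y = X" ..
  have "derives (insert \<phi> X) E" if "\<phi> \<in> formulas L - X" for \<phi>
    using bspec[OF max, of "insert \<phi> X"] X that by auto
  then show thesis using that[of X] X assms(3) by (simp add: maximal_theory_def)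
qed

section \<open>The canonical model and its truth conditions\<close>

definition theories :: "'c fm set set" where
  "theories = {T. \<exists>E. maximal_theory E T}"

text \<open>Formulas occurring in premises are instances of \<open>Atom i\<close> with \<open>i < n\<close>; evaluating \<open>Atom i\<close>
  as the \<open>i\<close>-th argument makes the definition structurally recursive.\<close>

primrec holds :: "'c fm \<Rightarrow> 'c fm set \<Rightarrow> bool" where
  "holds (Atom i) = (\<lambda>T. Atom i \<in> T)"
| "holds (Con c xs) = (\<lambda>T. Con c xs \<in> T \<or>
     (\<exists>Q. RightRule c Q \<in> G \<and> (\<forall>q\<in>Q. \<forall>T'\<in>theories. T \<subseteq> T' \<longrightarrow>
        assignment_sat (\<lambda>i. (map holds xs ! i) T') q)))"

definition canonical_model :: "('c fm set, 'c) semiframe" where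
  "canonical_model = \<lparr>worlds = theories, leq = {(T, T'). T \<in> theories \<and> T' \<in> theories \<and> T \<subseteq> T'},
     val = (\<lambda>T \<phi>. holds \<phi> T)\<rparr>"

lemma canonical_model_simps [simp]:
  "worlds canonical_model = theories"
  "(T, T') \<in> leq canonical_model \<longleftrightarrow> T \<in> theories \<and> T' \<in> theories \<and> T \<subseteq> T'"
  "val canonical_model T \<phi> = holds \<phi> T"
  by (simp_all add: canonical_model_def)

text \<open>Persistence needs no induction: both membership and a condition on all larger worlds are
  inherited upwards.\<close>

lemma holds_mono: "holds \<phi> T \<Longrightarrow> T \<subseteq> T' \<Longrightarrow> holds \<phi> T'"
  by (cases \<phi>; simp) (meson subset_iff subset_trans)+

lemma holds_member: "\<phi> \<in> T \<Longrightarrow> holds \<phi> T"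
  by (cases \<phi>) auto

text \<open>At a single world an instantiated clause is evaluated classically, under the assignment
  that reads off the truth of the instances. This is the link to coherence, which speaks of
  classical assignments.\<close>

lemma locally_true_subst_clause:
  assumes "is_subst L \<sigma>" "clauses_over n Q" "q \<in> Q"
  shows "locally_true (formulas L) canonical_model T (subst_seq \<sigma> q) \<longleftrightarrow>
     assignment_sat (\<lambda>i. holds (\<sigma> (Atom i)) T) q"
proof -
  have q: "seq_fms q \<subseteq> Atom ` {..<n}" using assms(2,3) by (auto simp: clauses_over_def)
  have "seq_fms (subst_seq \<sigma> q) \<subseteq> formulas L"
    using subst_clause_formulas[OF assms(2,3,1)]
    by (auto simp: subst_seq_def seq_fms_def option.set_map)
  then have "locally_true (formulas L) canonical_model T (subst_seq \<sigma> q) \<longleftrightarrow>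
     (\<exists>\<psi>\<in>lhs q. \<not> holds (\<sigma> \<psi>) T) \<or> (\<exists>\<phi>. rhs q = Some \<phi> \<and> holds (\<sigma> \<phi>) T)"
    by (auto simp: locally_true_def subst_seq_def)
  moreover have "\<exists>i. \<psi> = Atom i" if "\<psi> \<in> lhs q" for \<psi>
    using q that by (auto simp: seq_fms_def)
  moreover have "\<exists>i. \<phi> = Atom i" if "rhs q = Some \<phi>" for \<phi>
    using q that by (auto simp: seq_fms_def)
  ultimately show ?thesis unfolding assignment_sat_def by metis
qed

text \<open>Needed because the list access in \<open>holds\<close> is unspecified from index
  \<open>n\<close> on, where no premise looks.\<close>

lemma assignment_sat_cong:
  assumes "clauses_over n Q" "q \<in> Q" "\<And>i. i < n \<Longrightarrow> u i = u' i"
  shows "assignment_sat u q \<longleftrightarrow> assignment_sat u' q"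
proof -
  have q: "seq_fms q \<subseteq> Atom ` {..<n}" using assms by (auto simp: clauses_over_def)
  have "i < n" if "Atom i \<in> lhs q" for i
    using q that by (auto simp: seq_fms_def)
  moreover have "i < n" if "rhs q = Some (Atom i)" for i
    using q that by (auto simp: seq_fms_def)
  ultimately show ?thesis using assms(3) unfolding assignment_sat_def by blast
qed

text \<open>Trades the positional arguments in the recursion of \<open>holds\<close> for instances
  of atoms, the form in which rules are fulfilled.\<close>

lemma holds_subst_principal:
  assumes "is_subst L \<sigma>" "L c = Some n"
  shows "holds (\<sigma> (principal L c)) T \<longleftrightarrow> \<sigma> (principal L c) \<in> T \<or>
     (\<exists>Q. RightRule c Q \<in> G \<and> (\<forall>q\<in>Q. \<forall>T'\<in>theories. T \<subseteq> T' \<longrightarrow>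
        assignment_sat (\<lambda>i. holds (\<sigma> (Atom i)) T') q))"
proof -
  have eq: "assignment_sat (\<lambda>i. (map holds (map (\<lambda>i. \<sigma> (Atom i)) [0..<n]) ! i) T') q \<longleftrightarrow>
      assignment_sat (\<lambda>i. holds (\<sigma> (Atom i)) T') q"
    if "RightRule c Q \<in> G" "q \<in> Q" for Q q T'
  proof (rule assignment_sat_cong[OF _ that(2)])
    show "clauses_over n Q"
      using canonical that(1) assms(2) unfolding canonical_system_def by fastforce
  qed simp
  show ?thesis
    unfolding subst_principal[OF assms] holds.simps
    by (intro disj_cong refl ex_cong1 conj_cong ball_cong imp_cong) (rule eq)
qed

section \<open>From truth to derivability\<close>

text \<open>Otherwise some theory containing \<open>T\<close> and the instantiated antecedent is
  maximal for the succedent. There the antecedent is true by membership and any succedent is false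
  by \<open>false_arg\<close>, contradicting \<open>sat\<close>. The assumption
  \<open>false_arg\<close> is later supplied by an induction on formulas.\<close>

lemma derives_true_clause:
  assumes "is_subst L \<sigma>" "clauses_over n Q" "q \<in> Q" "T \<subseteq> formulas L"
    and sat: "\<And>T'. T' \<in> theories \<Longrightarrow> T \<subseteq> T' \<Longrightarrow> assignment_sat (\<lambda>i. holds (\<sigma> (Atom i)) T') q"
    and false_arg: "\<And>i T'. i < n \<Longrightarrow> maximal_theory (Some (\<sigma> (Atom i))) T' \<Longrightarrow>
      \<not> holds (\<sigma> (Atom i)) T'"
  shows "derives (T \<union> \<sigma> ` lhs q) (map_option \<sigma> (rhs q))"
proof (rule ccontr)
  assume "\<not> ?thesis"
  then obtain T' where T': "maximal_theory (map_option \<sigma> (rhs q)) T'" "T \<union> \<sigma> ` lhs q \<subseteq> T'"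
    by (rule maximal_theory_extension)
      (use subst_clause_formulas[OF assms(2,3,1)] assms(4) in auto)
  have q: "seq_fms q \<subseteq> Atom ` {..<n}" using assms(2,3) by (auto simp: clauses_over_def)
  have "assignment_sat (\<lambda>i. holds (\<sigma> (Atom i)) T') q"
    using sat T' by (auto simp: theories_def)
  then consider i where "Atom i \<in> lhs q" "\<not> holds (\<sigma> (Atom i)) T'"
    | i where "rhs q = Some (Atom i)" "holds (\<sigma> (Atom i)) T'"
    unfolding assignment_sat_def by blast
  then show False
  proof cases
    case 1
    then show False using T'(2) holds_member[of "\<sigma> (Atom i)" T'] by blast
  next
    case 2
    moreover have "i < n" using q 2 by (auto simp: seq_fms_def)
    ultimately show False using false_arg T'(1) by auto
  qed
qed

text \<open>If truth comes from a right rule, its premises are true in all larger worlds, hence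
  derivable from \<open>T\<close>, and the rule itself applies. This is the inductive step for
  \<open>not_holds_maximal_theory\<close>.\<close>

lemma holds_Con_imp_derives:
  assumes "holds (Con c xs) T" "Con c xs \<in> formulas L" "T \<subseteq> formulas L"
    and false_arg: "\<And>x T'. x \<in> set xs \<Longrightarrow> maximal_theory (Some x) T' \<Longrightarrow> \<not> holds x T'"
  shows "derives T (Some (Con c xs))"
proof -
  obtain c_xs: "L c = Some (length xs)" "set xs \<subseteq> formulas L"
    using assms(2) by (rule formulas_ConE)
  let ?\<sigma> = "inst xs"
  have \<sigma>: "is_subst L ?\<sigma>" using c_xs by (simp add: is_subst_inst)
  have eq: "?\<sigma> (principal L c) = Con c xs"
    unfolding subst_principal[OF \<sigma> c_xs(1)] by (auto intro: nth_equalityI)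
  consider "Con c xs \<in> T" | Q where "RightRule c Q \<in> G"
    "\<forall>q\<in>Q. \<forall>T'\<in>theories. T \<subseteq> T' \<longrightarrow> assignment_sat (\<lambda>i. holds (?\<sigma> (Atom i)) T') q"
    using assms(1) holds_subst_principal[OF \<sigma> c_xs(1), of T, unfolded eq] by metis
  then show ?thesis
  proof cases
    case 1
    then show ?thesis using derives_refl assms(2) by blast
  next
    case (2 Q)
    have n: "clauses_over (length xs) Q"
      using canonical 2(1) c_xs(1) unfolding canonical_system_def by fastforce
    have "derives T (Some (?\<sigma> (principal L c)))"
    proof (rule derives_right[OF 2(1) \<sigma> assms(3)])
      fix q assume "q \<in> Q"
      then show "derives (T \<union> ?\<sigma> ` lhs q) (map_option ?\<sigma> (rhs q))"
        using 2(2) false_arg assms(3) by (intro derives_true_clause[OF \<sigma> n]) simp_all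
    qed
    then show ?thesis unfolding eq .
  qed
qed

text \<open>Truth would yield derivability, which maximality forbids. The theory is arbitrary in the
  induction because the arguments are evaluated at other worlds.\<close>

lemma not_holds_maximal_theory:
  assumes "maximal_theory (Some \<phi>) T"
  shows "\<not> holds \<phi> T"
  using assms
proof (induction \<phi> arbitrary: T)
  case (Atom i)
  then show ?case using derives_refl by (auto simp: maximal_theory_def)
next
  case (Con c xs)
  have fms: "Con c xs \<in> formulas L" "T \<subseteq> formulas L" and "\<not> derives T (Some (Con c xs))"
    using Con.prems by (simp_all add: maximal_theory_def)
  then show ?case using holds_Con_imp_derives[OF _ fms Con.IH] by blast
qed

lemma holds_imp_derives:
  assumes "holds \<phi> T" "\<phi> \<in> formulas L" "T \<subseteq> formulas L"
  shows "derives T (Some \<phi>)"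
proof (cases \<phi>)
  case (Atom i)
  then show ?thesis using assms derives_refl by auto
next
  case (Con c xs)
  then show ?thesis using assms holds_Con_imp_derives[OF _ _ _ not_holds_maximal_theory] by simp
qed

text \<open>The only use of cut: were \<open>\<phi>\<close> missing, adding it would derive
  \<open>E\<close>, and cutting on \<open>\<phi>\<close> would derive \<open>E\<close> from
  \<open>T\<close> alone.\<close>

lemma member_if_derives_cut_formula:
  assumes "maximal_theory E T" "derives T (Some \<phi>)" "\<phi> \<in> C" "\<phi> \<in> formulas L"
  shows "\<phi> \<in> T"
proof (rule ccontr)
  assume "\<phi> \<notin> T"
  then have "derives (insert \<phi> T) E" using assms by (simp add: maximal_theory_def)
  then show False
    using derives_cut[OF assms(2) _ assms(3,4)] assms(1) unfolding maximal_theory_def by blast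
qed

section \<open>Frame conditions, the model property and refutation\<close>

lemma is_frame_canonical_model:
  assumes "theories \<noteq> {}"
  shows "is_frame L canonical_model"
proof -
  have "partial_order_on theories (leq canonical_model)"
    by (auto simp: partial_order_on_def preorder_on_def canonical_model_def
        intro!: refl_onI transI antisymI)
  moreover have "subformula_closed (formulas L)"
    unfolding subformula_closed_def by (blast elim: formulas_ConE)
  ultimately show ?thesis
    using assms holds_mono by (simp add: is_frame_def is_semiframe_def)
qed

text \<open>All formulas of \<open>q\<close> are cut formulas, so truth and membership agree for
  them, and a world containing the antecedent contains what the assumption \<open>q\<close> derives
  from it.\<close>

lemma is_model_canonical_model:
  assumes q: "q \<in> \<S>" and C: "seq_fms q \<subseteq> C"
  shows "is_model (formulas L) canonical_model q"
proof -
  have fms: "seq_fms q \<subseteq> formulas L" and fin: "finite (lhs q)"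
    using sequents[OF q] by (auto simp: is_sequent_def)
  have "locally_true (formulas L) canonical_model T q" if world: "T \<in> theories" for T
  proof (cases "\<forall>\<psi>\<in>lhs q. holds \<psi> T")
    case False
    then show ?thesis using fms by (auto simp: locally_true_def)
  next
    case True
    obtain E where E: "maximal_theory E T" using world by (auto simp: theories_def)
    then have T: "T \<subseteq> formulas L" by (simp add: maximal_theory_def)
    have "lhs q \<subseteq> T"
    proof
      fix \<psi> assume "\<psi> \<in> lhs q"
      then have "\<psi> \<in> formulas L" "\<psi> \<in> C" "holds \<psi> T"
        using True fms C by (auto simp: seq_fms_def)
      then show "\<psi> \<in> T"
        using member_if_derives_cut_formula[OF E] holds_imp_derives T by simp
    qed
    moreover have "prv (lhs q \<turnstile> rhs q)" using q by (simp add: provable.assumption)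
    ultimately have der: "derives T (rhs q)" using fin unfolding derives_def by blast
    show ?thesis
    proof (cases "rhs q")
      case None
      \<comment> \<open>An empty succedent would weaken to \<open>E\<close>, which \<open>T\<close>
        does not derive.\<close>
      then show ?thesis using der derives_weaken_right E by (auto simp: maximal_theory_def)
    next
      case (Some \<phi>)
      then have "\<phi> \<in> T"
        using member_if_derives_cut_formula[OF E] der fms C by (auto simp: seq_fms_def)
      then show ?thesis using Some fms holds_member by (auto simp: locally_true_def)
    qed
  qed
  then show ?thesis by (auto simp: is_model_def true_at_def)
qed

text \<open>A theory extending the antecedent and maximal for the succedent refutes
  \<open>q\<close>; its existence also shows that there are worlds at all.\<close>

lemma not_is_model_canonical_model:
  assumes "is_sequent L q" "\<not> prv q"
  shows "theories \<noteq> {}" "\<not> is_model (formulas L) canonical_model q"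
proof -
  have q: "lhs q \<subseteq> formulas L" "set_option (rhs q) \<subseteq> formulas L" "finite (lhs q)"
    using assms(1) by (auto simp: is_sequent_def seq_fms_def)
  have "\<not> derives (lhs q) (rhs q)"
    using assms(2) q prv_weaken_left unfolding derives_def by (metis sequent.collapse)
  then obtain T where T: "maximal_theory (rhs q) T" "lhs q \<subseteq> T"
    using maximal_theory_extension q by blast
  then have world: "T \<in> theories" by (auto simp: theories_def)
  then show "theories \<noteq> {}" by auto
  have "\<not> locally_true (formulas L) canonical_model T q"
    using T holds_member not_holds_maximal_theory by (auto simp: locally_true_def)
  then show "\<not> is_model (formulas L) canonical_model q"
    using world by (auto simp: is_model_def true_at_def)
qed

section \<open>Legality\<close>

lemma respects_right_rule:
  assumes r: "RightRule c Q \<in> G"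
  shows "respects_rule L (formulas L) canonical_model (RightRule c Q)"
  unfolding respects_rule_def
proof (intro ballI allI impI)
  fix T \<sigma>
  assume T: "T \<in> worlds canonical_model" and \<sigma>: "is_subst L \<sigma>"
    and ful: "fulfils (formulas L) canonical_model T \<sigma> (RightRule c Q)"
    and p: "\<sigma> (principal L (rule_connective (RightRule c Q))) \<in> formulas L"
  obtain n where n: "L c = Some n" "clauses_over n Q"
    using canonical r unfolding canonical_system_def by fastforce
  have "\<forall>q\<in>Q. \<forall>T'\<in>theories. T \<subseteq> T' \<longrightarrow> assignment_sat (\<lambda>i. holds (\<sigma> (Atom i)) T') q"
    using ful T locally_true_subst_clause[OF \<sigma> n(2)] by (simp add: true_at_def)
  then have "holds (\<sigma> (principal L c)) T"
    using holds_subst_principal[OF \<sigma> n(1)] r by blast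
  then show "locally_true (formulas L) canonical_model T
      (subst_seq \<sigma> (rule_conclusion L (RightRule c Q)))"
    using p by (simp add: locally_true_def subst_seq_def seq_fms_def)
qed

lemma respects_left_rule:
  assumes r: "LeftRule c H Q \<in> G" and coherent: "coherent G"
  shows "respects_rule L (formulas L) canonical_model (LeftRule c H Q)"
  unfolding respects_rule_def
proof (intro ballI allI impI)
  fix T \<sigma>
  assume "T \<in> worlds canonical_model" and \<sigma>: "is_subst L \<sigma>"
    and ful: "fulfils (formulas L) canonical_model T \<sigma> (LeftRule c H Q)"
    and p: "\<sigma> (principal L (rule_connective (LeftRule c H Q))) \<in> formulas L"
  then have T: "T \<in> theories" by simp
  then obtain E where E: "maximal_theory E T" by (auto simp: theories_def)
  obtain n where n: "L c = Some n" "clauses_over n H" "clauses_over n Q"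
    and neg: "\<forall>q\<in>Q. rhs q = None"
    using canonical r unfolding canonical_system_def by fastforce
  have hard: "assignment_sat (\<lambda>i. holds (\<sigma> (Atom i)) T') q"
    if "q \<in> H" "T' \<in> theories" "T \<subseteq> T'" for q T'
    using ful T that locally_true_subst_clause[OF \<sigma> n(2)] by (simp add: true_at_def)
  have soft: "assignment_sat (\<lambda>i. holds (\<sigma> (Atom i)) T) q" if "q \<in> Q" for q
    using ful that locally_true_subst_clause[OF \<sigma> n(3)] by simp
  have "\<not> holds (\<sigma> (principal L c)) T"
  proof
    assume "holds (\<sigma> (principal L c)) T"
    then consider "\<sigma> (principal L c) \<in> T" | Q' where "RightRule c Q' \<in> G"
      "\<forall>q\<in>Q'. assignment_sat (\<lambda>i. holds (\<sigma> (Atom i)) T) q"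
      using holds_subst_principal[OF \<sigma> n(1), of T] T by (metis subset_refl)
    then show False
    proof cases
      case 1
      have "derives T E"
      proof (rule derives_left[OF r \<sigma> _ _ _ _ 1])
        fix q assume "q \<in> H"
        then show "derives (T \<union> \<sigma> ` lhs q) (map_option \<sigma> (rhs q))"
          using hard E not_holds_maximal_theory
          by (intro derives_true_clause[OF \<sigma> n(2)]) (auto simp: maximal_theory_def)
      next
        \<comment> \<open>A soft premise has no succedent, so it holds at \<open>T\<close> through a
          false antecedent formula. False formulas are not members, hence by maximality adding this
          one to \<open>T\<close> derives \<open>E\<close>.\<close>
        fix q assume q: "q \<in> Q"
        then obtain i where i: "Atom i \<in> lhs q" "\<not> holds (\<sigma> (Atom i)) T"
          using soft neg by (fastforce simp: assignment_sat_def)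
        moreover have "\<sigma> (Atom i) \<in> formulas L"
          using \<sigma> by (auto simp: is_subst_def intro: formulas.atom)
        ultimately have "derives (insert (\<sigma> (Atom i)) T) E"
          using E holds_member by (auto simp: maximal_theory_def)
        then show "derives (T \<union> \<sigma> ` lhs q) E"
          by (rule derives_mono) (use i in auto)
      qed (use E in \<open>auto simp: maximal_theory_def\<close>)
      then show False using E by (simp add: maximal_theory_def)
    next
      case (2 Q')
      \<comment> \<open>Hard and right premises hold in all worlds above \<open>T\<close>, in
        particular at \<open>T\<close>; with the soft ones they are satisfied by one classical
        assignment.\<close>
      then have "\<forall>q \<in> H \<union> Q \<union> Q'. assignment_sat (\<lambda>i. holds (\<sigma> (Atom i)) T) q"
        using hard[OF _ T] soft by blast
      then show False using coherent r 2(1) unfolding coherent_def by blast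
    qed
  qed
  then show "locally_true (formulas L) canonical_model T
      (subst_seq \<sigma> (rule_conclusion L (LeftRule c H Q)))"
    using p by (simp add: locally_true_def subst_seq_def seq_fms_def)
qed

lemma legal_canonical_model:
  assumes "coherent G"
  shows "legal L G (formulas L) canonical_model"
  unfolding legal_def
proof
  fix r assume "r \<in> G"
  then show "respects_rule L (formulas L) canonical_model r"
    using assms respects_right_rule respects_left_rule by (cases r) auto
qed

end

theorem theorem6p3:
  fixes L :: "'c \<rightharpoonup> nat" and G :: "'c rule set"
    and \<S> :: "'c sequent set" and s :: "'c sequent"
  assumes "canonical_system L G"
    and "coherent G"
    and "\<forall>q \<in> \<S> \<union> {s}. is_sequent L q"
  shows "S_provable L G \<S> s \<or>
    (\<exists>M :: ('c fm set, 'c) semiframe.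
       is_frame L M \<and> legal L G (formulas L) M \<and>
       (\<forall>q\<in>\<S>. is_model (formulas L) M q) \<and> \<not> is_model (formulas L) M s)"
proof (cases "S_provable L G \<S> s")
  case False
  \<comment> \<open>The cut formulas are exactly those occurring in \<open>\<S>\<close>, so
    provability in the locale is \<open>S_provable\<close>.\<close>
  interpret canonical_calculus L G \<S> "\<Union>p\<in>\<S>. seq_fms p"
    using assms(1,3) by (simp add: canonical_calculus_def)
  have s: "theories \<noteq> {}" "\<not> is_model (formulas L) canonical_model s"
    using not_is_model_canonical_model[of s] assms(3) False by (auto simp: S_provable_def)
  have "\<forall>q\<in>\<S>. is_model (formulas L) canonical_model q"
    using is_model_canonical_model by blast
  then show ?thesis
    using s is_frame_canonical_model legal_canonical_model[OF assms(2)] by blast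
qed simp

end
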